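(* Let $\Pi$ be a hereditary graph property, and let $Q:(0,1)\to\mathbb{N}$. Then the following hold. (i) If $\Pi$ admits a size-oblivious one-sided-error tester with query complexity at most $Q(\varepsilon)$, then there is an absolute constant $c\in(0,1)$ such that, for every $\varepsilon>0$, the property $\Pi$ admits an $(\varepsilon,\eta(\varepsilon),N(\varepsilon),q(\varepsilon))$-ordered container lemma with parameters satisfying $$q(\varepsilon)=O(Q(c\varepsilon)),\qquad \eta(\varepsilon)=\Omega\!\left(Q(c\varepsilon)^{-1}\right),\qquad N(\varepsilon)=O(Q(c\varepsilon)).$$ (ii) Conversely, if for every $\varepsilon$ the property $\Pi$ admits an $(\varepsilon,\eta(\varepsilon),N(\varepsilon),q(\varepsilon))$-ordered container lemma, then $\Pi$ admits a size-oblivious one-sided-error tester with query complexity $$\widetilde O\!\left(N(\varepsilon)^2+\frac{(q(\varepsilon)+1)^2}{\eta(\varepsilon)^2}\right).$$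
   Context: A graph is a finite simple labelled graph (no loops, no multiple edges). A graph property is a family of graphs closed under isomorphism; it is hereditary if it is closed under taking induced subgraphs. Distance: for graphs $G,G'$ on the same $n$-element vertex set, $\mathrm{dist}(G,G')=|E(G)\triangle E(G')|/n^2$, and $\mathrm{dist}(G,\Pi)$ is the minimum of $\mathrm{dist}(G,G')$ over $G'\in\Pi$ with $V(G')=V(G)$ (the minimum over the empty set being $+\infty$). $G$ is $\varepsilon$-far from $\Pi$ if $\mathrm{dist}(G,\Pi)>\varepsilon$, and $\varepsilon$-close otherwise. Tester: a size-oblivious tester for $\Pi$ is a randomized oracle algorithm which, given $\varepsilon>0$ but not $|V(G)|$, has oracle access to the adjacency predicate of $G$ and to independent uniform samples from $V(G)$, accepts every $G\in\Pi$ with probability at least $2/3$, and rejects every $G$ that is $\varepsilon$-far from $\Pi$ with probability at least $2/3$. Its query complexity is the maximum number of adjacency queries it makes and its sample complexity is the maximum number of vertex labels it inspects; both must be bounded in terms of $\varepsilon$ only. It has one-sided error if it accepts every graph in $\Pi$ with probability one. Complexity bounds are tacitly replaced by their nonincreasing monotone closures in $\varepsilon$. A canonical tester samples a uniformly random vertex set $S$ of a prescribed size (depending only on $\varepsilon$), queries every pair in $S$, and decides from the isomorphism type of $G[S]$; if the prescribed size exceeds $|V(G)|$, it inspects the whole graph. Standing convention (canonicalization theorem of Goldreich and Trevisan): a size-oblivious tester making at most $Q(\varepsilon)$ adjacency queries is taken to be convertible, preserving one-sidedness and after changing $\varepsilon$ by an absolute constant factor, into a canonical tester sampling $O(Q(\varepsilon))$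 vertices. Ordered container lemma: for a set $V$, $V_{\neq}^{j}$ denotes the ordered $j$-tuples of distinct elements of $V$, and $\binom{V}{\le x}$ the subsets of $V$ of size at most $x$. For $\varepsilon,\eta>0$ and integers $N,q\ge0$, $\Pi$ admits an $(\varepsilon,\eta,N,q)$-ordered container lemma if for every $n\ge N$ and every $n$-vertex graph $G=(V,E)$ that is $\varepsilon$-far from $\Pi$ there exist maps $$f:\{U\subseteq V:G[U]\in\Pi\}\to\bigcup_{j=0}^{q}V_{\neq}^{j},\qquad C:\operatorname{im}(f)\to\binom{V}{\le(1-\eta)n},$$ such that every entry of $f(U)$ belongs to $U$ and $U\subseteq C(f(U))$ whenever $G[U]\in\Pi$. $\widetilde O(\cdot)$ hides polylogarithmic factors in the displayed quantities. Implied constants are absolute. *)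

theory Defs
  imports "HOL-Probability.Probability"
begin

section \<open>Graphs and hereditary properties\<close>

text \<open>A graph is a pair of a finite vertex set (any finite set of natural numbers, possibly empty)
  and a set of two-element sets of vertices.\<close>

type_synonym graph = "nat set \<times> nat set set"

abbreviation verts :: "graph \<Rightarrow> nat set" where "verts \<equiv> fst"
abbreviation edges :: "graph \<Rightarrow> nat set set" where "edges \<equiv> snd"

definition is_graph :: "graph \<Rightarrow> bool" where
  "is_graph G \<longleftrightarrow> finite (verts G) \<and> (\<forall>e\<in>edges G. e \<subseteq> verts G \<and> card e = 2)"

definition isomorphic :: "graph \<Rightarrow> graph \<Rightarrow> bool" where
  "isomorphic G H \<longleftrightarrow>
     (\<exists>\<phi>. bij_betw \<phi> (verts G) (verts H) \<and> edges H = (\<lambda>e. \<phi> ` e) ` edges G)"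

definition induced :: "graph \<Rightarrow> nat set \<Rightarrow> graph" where
  "induced G U = (U, {e \<in> edges G. e \<subseteq> U})"

definition graph_property :: "graph set \<Rightarrow> bool" where
  "graph_property P \<longleftrightarrow>
     (\<forall>G\<in>P. is_graph G) \<and> (\<forall>G\<in>P. \<forall>H. is_graph H \<and> isomorphic G H \<longrightarrow> H \<in> P)"

definition hereditary_property :: "graph set \<Rightarrow> bool" where
  "hereditary_property P \<longleftrightarrow>
     graph_property P \<and> (\<forall>G\<in>P. \<forall>U. U \<subseteq> verts G \<longrightarrow> induced G U \<in> P)"

section \<open>Distance\<close>

definition graph_dist :: "graph \<Rightarrow> graph \<Rightarrow> real" where
  "graph_dist G H =
     real (card ((edges G - edges H) \<union> (edges H - edges G))) / real (card (verts G)) ^ 2"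

text \<open>There are finitely many candidates, so the infimum is a minimum if there is a candidate,
  and it is \<open>\<infinity>\<close> otherwise.\<close>

definition property_dist :: "graph \<Rightarrow> graph set \<Rightarrow> ereal" where
  "property_dist G P = (INF H\<in>{H \<in> P. verts H = verts G}. ereal (graph_dist G H))"

definition far :: "real \<Rightarrow> graph \<Rightarrow> graph set \<Rightarrow> bool" where
  "far \<epsilon> G P \<longleftrightarrow> property_dist G P > ereal \<epsilon>"

section \<open>Size-oblivious testers\<close>

text \<open>A randomized oracle algorithm is a decision tree: it halts with a verdict, tosses internal
  coins, asks for a uniformly random vertex (and sees its label), or asks whether two vertices are
  adjacent. It is not given the vertex set or its size.\<close>

datatype oracle_alg =
    Halt bool
  | Toss "nat pmf" "nat \<Rightarrow> oracle_alg"
  | Sample "nat \<Rightarrow> oracle_alg"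
  | Query nat nat "bool \<Rightarrow> oracle_alg"

text \<open>The result of a run: the verdict (\<open>True\<close> means accept), the number of adjacency queries and
  the number of vertex samples.\<close>

type_synonym outcome = "bool \<times> nat \<times> nat"

primrec run :: "graph \<Rightarrow> oracle_alg \<Rightarrow> outcome pmf" where
  "run G (Halt b) = return_pmf (b, 0, 0)"
| "run G (Toss p k) = bind_pmf p (\<lambda>i. run G (k i))"
| "run G (Sample k) = bind_pmf (pmf_of_set (verts G))
     (\<lambda>v. map_pmf (\<lambda>(b, m, s). (b, m, Suc s)) (run G (k v)))"
| "run G (Query u v k) = map_pmf (\<lambda>(b, m, s). (b, Suc m, s)) (run G (k ({u, v} \<in> edges G)))"

text \<open>The algorithm can name only vertices that it has sampled: all queried labels lie in \<open>X\<close> or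
  were sampled earlier in the run.\<close>

primrec queries_sampled :: "nat set \<Rightarrow> oracle_alg \<Rightarrow> bool" where
  "queries_sampled X (Halt b) \<longleftrightarrow> True"
| "queries_sampled X (Toss p k) \<longleftrightarrow> (\<forall>i. queries_sampled X (k i))"
| "queries_sampled X (Sample k) \<longleftrightarrow> (\<forall>v. queries_sampled (insert v X) (k v))"
| "queries_sampled X (Query u v k) \<longleftrightarrow> u \<in> X \<and> v \<in> X \<and> (\<forall>b. queries_sampled X (k b))"

definition accept_prob :: "graph \<Rightarrow> oracle_alg \<Rightarrow> real" where
  "accept_prob G A = measure_pmf.prob (run G A) {(b, m, s). b}"

definition reject_prob :: "graph \<Rightarrow> oracle_alg \<Rightarrow> real" where
  "reject_prob G A = measure_pmf.prob (run G A) {(b, m, s). \<not> b}"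

text \<open>Uniform vertex samples exist only if there is a vertex, so inputs are nonempty graphs.\<close>

definition input_graph :: "graph \<Rightarrow> bool" where
  "input_graph G \<longleftrightarrow> is_graph G \<and> verts G \<noteq> {}"

definition query_complexity_le :: "oracle_alg \<Rightarrow> real \<Rightarrow> bool" where
  "query_complexity_le A B \<longleftrightarrow>
     (\<forall>G. input_graph G \<longrightarrow> (\<forall>(b, m, s) \<in> set_pmf (run G A). real m \<le> B))"

definition sample_complexity_le :: "oracle_alg \<Rightarrow> real \<Rightarrow> bool" where
  "sample_complexity_le A B \<longleftrightarrow>
     (\<forall>G. input_graph G \<longrightarrow> (\<forall>(b, m, s) \<in> set_pmf (run G A). real s \<le> B))"

text \<open>\<open>T \<epsilon>\<close> is the algorithm on proximity parameter \<open>\<epsilon>\<close>.\<close>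

definition size_oblivious_tester :: "graph set \<Rightarrow> (real \<Rightarrow> oracle_alg) \<Rightarrow> bool" where
  "size_oblivious_tester P T \<longleftrightarrow>
     (\<forall>\<epsilon>>0. queries_sampled {} (T \<epsilon>)
        \<and> (\<exists>B. query_complexity_le (T \<epsilon>) B) \<and> (\<exists>B. sample_complexity_le (T \<epsilon>) B)
        \<and> (\<forall>G. input_graph G \<and> G \<in> P \<longrightarrow> accept_prob G (T \<epsilon>) \<ge> 2/3)
        \<and> (\<forall>G. input_graph G \<and> far \<epsilon> G P \<longrightarrow> reject_prob G (T \<epsilon>) \<ge> 2/3))"

definition one_sided_tester :: "graph set \<Rightarrow> (real \<Rightarrow> oracle_alg) \<Rightarrow> bool" where
  "one_sided_tester P T \<longleftrightarrow>
     size_oblivious_tester P T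
     \<and> (\<forall>\<epsilon>>0. \<forall>G. input_graph G \<and> G \<in> P \<longrightarrow> accept_prob G (T \<epsilon>) = 1)"

definition admits_one_sided_tester :: "graph set \<Rightarrow> real set \<Rightarrow> (real \<Rightarrow> real) \<Rightarrow> bool" where
  "admits_one_sided_tester P I B \<longleftrightarrow>
     (\<exists>T. one_sided_tester P T \<and> (\<forall>\<epsilon>\<in>I. query_complexity_le (T \<epsilon>) (B \<epsilon>)))"

section \<open>Canonical testers\<close>

text \<open>The uniformly random set of \<open>s\<close> vertices; the whole vertex set if there are fewer than \<open>s\<close>.\<close>

definition vertex_sample :: "graph \<Rightarrow> nat \<Rightarrow> nat set pmf" where
  "vertex_sample G s = pmf_of_set {S. S \<subseteq> verts G \<and> card S = min s (card (verts G))}"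

text \<open>With parameter \<open>\<epsilon>\<close> the tester samples \<open>s \<epsilon>\<close> vertices and accepts iff the graph they induce
  lies in the isomorphism-closed family \<open>D \<epsilon>\<close>.\<close>

definition one_sided_canonical_tester ::
    "graph set \<Rightarrow> (real \<Rightarrow> nat) \<Rightarrow> (real \<Rightarrow> graph set) \<Rightarrow> bool" where
  "one_sided_canonical_tester P s D \<longleftrightarrow>
     (\<forall>\<epsilon>>0. graph_property (D \<epsilon>)
        \<and> (\<forall>G. input_graph G \<and> G \<in> P \<longrightarrow>
             measure_pmf.prob (vertex_sample G (s \<epsilon>)) {S. induced G S \<in> D \<epsilon>} = 1)
        \<and> (\<forall>G. input_graph G \<and> far \<epsilon> G P \<longrightarrow>
             measure_pmf.prob (vertex_sample G (s \<epsilon>)) {S. induced G S \<notin> D \<epsilon>} \<ge> 2/3))"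

text \<open>The Goldreich--Trevisan convention for one-sided testers of \<open>P\<close> making at most \<open>Q \<epsilon>\<close>
  queries, with constants \<open>c\<^sub>0\<close> (change of \<open>\<epsilon>\<close>) and \<open>K\<^sub>0\<close> (implied constant). It is stated for
  given \<open>P\<close> and \<open>Q\<close> because it does not hold for all of them: sampling alone, without
  any query, tests the property of having at most \<open>m\<close> vertices, but no canonical tester
  for it has sample size bounded independently of \<open>m\<close>.\<close>

definition canonicalization_convention ::
    "real \<Rightarrow> real \<Rightarrow> graph set \<Rightarrow> (real \<Rightarrow> nat) \<Rightarrow> bool" where
  "canonicalization_convention c\<^sub>0 K\<^sub>0 P Q \<longleftrightarrow>
     (admits_one_sided_tester P {0<..<1} (\<lambda>\<epsilon>. real (Q \<epsilon>)) \<longrightarrow>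
       (\<exists>s D. one_sided_canonical_tester P s D
          \<and> (\<forall>\<epsilon>>0. c\<^sub>0 * \<epsilon> < 1 \<longrightarrow> real (s \<epsilon>) \<le> K\<^sub>0 * real (Q (c\<^sub>0 * \<epsilon>)))))"

section \<open>Ordered container lemma\<close>

definition members_in :: "graph set \<Rightarrow> graph \<Rightarrow> nat set set" where
  "members_in P G = {U. U \<subseteq> verts G \<and> induced G U \<in> P}"

definition ordered_container_lemma ::
    "graph set \<Rightarrow> real \<Rightarrow> real \<Rightarrow> nat \<Rightarrow> nat \<Rightarrow> bool" where
  "ordered_container_lemma P \<epsilon> \<eta> N q \<longleftrightarrow>
     \<epsilon> > 0 \<and> \<eta> > 0 \<and>
     (\<forall>G. is_graph G \<and> card (verts G) \<ge> N \<and> far \<epsilon> G P \<longrightarrow>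
       (\<exists>f C. f \<in> members_in P G \<rightarrow> {xs. distinct xs \<and> set xs \<subseteq> verts G \<and> length xs \<le> q}
          \<and> C \<in> f ` members_in P G \<rightarrow>
              {W. W \<subseteq> verts G \<and> real (card W) \<le> (1 - \<eta>) * real (card (verts G))}
          \<and> (\<forall>U\<in>members_in P G. set (f U) \<subseteq> U \<and> U \<subseteq> C (f U))))"

section \<open>Query bound obtained from a container lemma\<close>

definition container_query_bound :: "nat \<Rightarrow> real \<Rightarrow> nat \<Rightarrow> real" where
  "container_query_bound N \<eta> q = real N ^ 2 + (real q + 1) ^ 2 / \<eta> ^ 2"

text \<open>The bound \<open>X\<close> up to the constant \<open>K\<close> and a polylogarithmic factor of exponent \<open>k\<close>.\<close>

definition soft_bound :: "real \<Rightarrow> nat \<Rightarrow> real \<Rightarrow> real" where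
  "soft_bound K k X = K * X * log 2 (2 + X) ^ k"

end

theory Submission
  imports Defs
begin

text \<open>Two arguments carry the equivalence.

  From testers to containers: let \<open>G\<close> be far from the property. A one-sided canonical tester rejects
  at least two thirds of all \<open>s\<close>-sets of vertices, and by heredity no rejected \<open>s\<close>-set lies inside a
  vertex set \<open>U\<close> with \<open>G[U]\<close> in the property. So such sets are independent in a dense \<open>s\<close>-uniform
  hypergraph, and it suffices to find containers for the independent sets of a dense hypergraph
  (\<open>dense_hypergraph_containers\<close>). Call a set \<open>W\<close> heavy if more than a
  fraction \<open>(1 - |W| / s) / 2\<close> of the \<open>s\<close>-sets containing it are edges. A maximum heavy subset
  \<open>W\<close> of an independent set \<open>U\<close> has fewer than \<open>s\<close> elements. Averaging shows that a fraction
  \<open>\<Omega>(1/s)\<close> of the vertices extends \<open>W\<close> to a heavy set (\<open>many_heavy_extensions\<close>), and by maximality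
  \<open>U\<close> avoids all of them. The remaining vertices form the container, with \<open>W\<close> as fingerprint. The order
  of the fingerprint is immaterial here, so \<open>W\<close> is listed increasingly.

  From containers to testers: sample \<open>m\<close> vertices, query all pairs, and accept iff the graph induced
  by the sample is in the property; heredity makes this one-sided. If a far graph is accepted, the
  sample contains its own fingerprint, and all remaining samples fall into the container determined by
  the fingerprint. There are at most \<open>(q + 1) m ^ q\<close> choices for the positions of the fingerprint, and
  each gives an event of probability at most \<open>(1 - \<eta>) ^ (m - q)\<close>
  (\<open>containers_capture_few_lists\<close>), so \<open>m = O(a (1 + ln a))\<close> with \<open>a = (q + 1) / \<eta>\<close> samples suffice
  (\<open>container_union_bound\<close>). Container lemmas say nothing about graphs with fewer than \<open>N\<close> vertices;
  for these, another \<open>O(N (1 + ln N))\<close> samples reveal the whole graph with probability at least \<open>2/3\<close>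
  (\<open>coupon_collector_bound\<close>).\<close>

section \<open>Containers for dense uniform hypergraphs\<close>

lemma card_supersets_le:
  assumes "finite V" "W \<subseteq> V" "\<B> \<subseteq> {S. S \<subseteq> V \<and> card S = s}"
  shows "card {S \<in> \<B>. W \<subseteq> S} \<le> (card V - card W) choose (s - card W)"
proof -
  have fW: "finite W" using assms finite_subset by blast
  have "inj_on (\<lambda>S. S - W) {S \<in> \<B>. W \<subseteq> S}" by (rule inj_onI) auto
  moreover have "(\<lambda>S. S - W) ` {S \<in> \<B>. W \<subseteq> S} \<subseteq> {T. T \<subseteq> V - W \<and> card T = s - card W}"
    using assms fW by (auto simp: card_Diff_subset)
  moreover have "finite {T. T \<subseteq> V - W \<and> card T = s - card W}"
    using assms(1) by simp
  ultimately have "card {S \<in> \<B>. W \<subseteq> S} \<le> card {T. T \<subseteq> V - W \<and> card T = s - card W}"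
    by (rule card_inj_on_le)
  also have "\<dots> = (card V - card W) choose (s - card W)"
    using assms fW by (simp add: n_subsets card_Diff_subset)
  finally show ?thesis .
qed

text \<open>Double counting: an edge \<open>S\<close> containing \<open>W\<close> is counted once for each of the vertices of
  \<open>S - W\<close>.\<close>

lemma sum_card_supersets_insert:
  assumes "finite V" "W \<subseteq> V" "\<B> \<subseteq> {S. S \<subseteq> V \<and> card S = s}"
  shows "(\<Sum>v\<in>V - W. card {S \<in> \<B>. insert v W \<subseteq> S}) = (s - card W) * card {S \<in> \<B>. W \<subseteq> S}"
proof -
  have fW: "finite W" using assms finite_subset by blast
  have fB: "finite {S \<in> \<B>. W \<subseteq> S}"
    by (rule finite_subset[of _ "Pow V"]) (use assms in auto)
  have cd: "card {v \<in> V - W. v \<in> S} = s - card W" if "S \<in> {S \<in> \<B>. W \<subseteq> S}" for S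
  proof -
    have "{v \<in> V - W. v \<in> S} = S - W" using that assms(3) by auto
    then show ?thesis using that assms(3) fW by (auto simp: card_Diff_subset)
  qed
  have "(\<Sum>v\<in>V - W. card {S \<in> {S \<in> \<B>. W \<subseteq> S}. v \<in> S}) = (\<Sum>S\<in>{S \<in> \<B>. W \<subseteq> S}. s - card W)"
    by (rule sum_multicount_gen) (use assms fB cd in auto)
  moreover have "{S \<in> {S \<in> \<B>. W \<subseteq> S}. v \<in> S} = {S \<in> \<B>. insert v W \<subseteq> S}" for v by auto
  ultimately show ?thesis by simp
qed

text \<open>Among the \<open>s\<close>-sets containing \<open>W\<close>, more than a fraction \<open>d (1 - |W| / s)\<close> are edges. The
  threshold starts at \<open>d\<close>, below the density of the hypergraph, and drops by \<open>d / s\<close> per vertex, so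
  that it is still nonnegative when \<open>|W| = s\<close>: a heavy set of size \<open>s\<close> is contained in an edge, hence
  is an edge.\<close>

definition heavy :: "'a set \<Rightarrow> 'a set set \<Rightarrow> nat \<Rightarrow> real \<Rightarrow> 'a set \<Rightarrow> bool" where
  "heavy V \<B> s d W \<longleftrightarrow>
     real (card {S \<in> \<B>. W \<subseteq> S})
       > d * (1 - real (card W) / real s) * real ((card V - card W) choose (s - card W))"

text \<open>Averaging: the edge density above \<open>W\<close> is the mean, over \<open>v\<close> outside \<open>W\<close>, of the densities above
  \<open>W \<union> {v}\<close>. Densities are at most 1, so if the mean exceeds one threshold, a fraction at least
  \<open>d / s\<close> of the vertices must reach the next one. The assumption \<open>2 s \<le> |V|\<close> ensures that at
  least half of all vertices lie outside \<open>W\<close>.\<close>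

lemma many_heavy_extensions:
  assumes V: "finite V" "W \<subseteq> V" and B: "\<B> \<subseteq> {S. S \<subseteq> V \<and> card S = s}"
    and s: "card W < s" "2 * s \<le> card V" and d: "0 < d" and h: "heavy V \<B> s d W"
  shows "real (card {v \<in> V - W. heavy V \<B> s d (insert v W)}) \<ge> d / (2 * real s) * real (card V)"
proof -
  define n j where "n = card V" and "j = card W"
  define b where "b = (n - Suc j) choose (s - Suc j)"
  define H where "H = {v \<in> V - W. heavy V \<B> s d (insert v W)}"
  define t where "t = d * (1 - real (Suc j) / real s)"
  let ?cnt = "\<lambda>W. card {S \<in> \<B>. W \<subseteq> S}"
  have fW: "finite W" using V finite_subset by blast
  have js: "j < s" "2 * s \<le> n" using s by (auto simp: n_def j_def)
  have b0: "0 < b" using js by (simp add: b_def)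
  have t0: "0 \<le> t" using d js by (simp add: t_def)
  have cardVW: "card (V - W) = n - j" using V fW by (simp add: n_def j_def card_Diff_subset)
  have ins: "card (insert v W) = Suc j" if "v \<in> V - W" for v
    using that fW by (simp add: j_def)
  \<comment> \<open>\<open>b\<close> counts all \<open>s\<close>-sets above \<open>W \<union> {v}\<close>, and \<open>t\<close> is the threshold at size \<open>|W| + 1\<close>.\<close>
  have le: "real (?cnt (insert v W)) \<le> (if v \<in> H then real b else 0) + t * real b" if v: "v \<in> V - W" for v
  proof (cases "v \<in> H")
    case True
    have "?cnt (insert v W) \<le> b"
      using card_supersets_le[OF V(1) _ B, of "insert v W"] v V(2) ins[OF v]
      by (simp add: b_def n_def)
    moreover have "0 \<le> t * real b" using t0 by simp
    ultimately show ?thesis using True by simp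
  next
    case False
    then show ?thesis using v ins[OF v] by (simp add: H_def heavy_def t_def b_def n_def)
  qed
  have "real ((s - j) * ?cnt W) = (\<Sum>v\<in>V - W. real (?cnt (insert v W)))"
    unfolding j_def sum_card_supersets_insert[OF V B, symmetric] of_nat_sum ..
  also have "\<dots> \<le> (\<Sum>v\<in>V - W. (if v \<in> H then real b else 0) + t * real b)"
    by (rule sum_mono) (rule le)
  also have "\<dots> = real (card H) * real b + real (n - j) * (t * real b)"
  proof -
    have "(V - W) \<inter> H = H" by (auto simp: H_def)
    then show ?thesis using V by (simp add: sum.distrib sum.If_cases cardVW)
  qed
  finally have up: "real (s - j) * real (?cnt W) \<le> (real (card H) + real (n - j) * t) * real b"
    by (simp add: ring_distribs mult.assoc)
  have absorb: "real (s - j) * real ((n - j) choose (s - j)) = real (n - j) * real b"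
    using times_binomial_minus1_eq[of "s - j" "n - j"] js
    unfolding b_def of_nat_mult[symmetric] by simp
  have "d * (1 - real j / real s) * (real (n - j) * real b)
      = real (s - j) * (d * (1 - real j / real s) * real ((n - j) choose (s - j)))"
    unfolding absorb[symmetric] by simp
  also have "\<dots> \<le> real (s - j) * real (?cnt W)"
    using h by (intro mult_left_mono) (auto simp: heavy_def n_def j_def)
  also have "\<dots> \<le> (real (card H) + real (n - j) * t) * real b" by (rule up)
  finally have "(d * (1 - real j / real s) * real (n - j)) * real b
      \<le> (real (card H) + real (n - j) * t) * real b" by (simp add: algebra_simps)
  then have "d * (1 - real j / real s) * real (n - j) \<le> real (card H) + real (n - j) * t"
    using b0 by simp
  moreover have "d * (1 - real j / real s) * real (n - j) - real (n - j) * t = d / real s * real (n - j)"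
    using js by (simp add: t_def field_simps)
  moreover have "d / real s * real (n - j) \<ge> d / real s * (real n / 2)"
    using js d by (intro mult_left_mono) auto
  ultimately show ?thesis unfolding H_def n_def by simp
qed

text \<open>The fingerprint of an independent set \<open>U\<close> is a heavy set \<open>W \<subseteq> U\<close> of maximum size. Since \<open>U\<close>
  contains no edge, \<open>|W| < s\<close>; by maximality, no vertex of \<open>U\<close> outside \<open>W\<close> extends \<open>W\<close> to a heavy
  set. So \<open>U\<close> avoids all heavy extensions of \<open>W\<close>. These depend on \<open>W\<close> alone, and there are many of
  them; their complement is the container.\<close>

lemma dense_hypergraph_containers:
  fixes V :: "'a set"
  assumes V: "finite V" and B: "\<B> \<subseteq> {S. S \<subseteq> V \<and> card S = s}"
    and s: "0 < s" "2 * s \<le> card V" and d: "0 < d"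
    and dense: "real (card \<B>) > d * real (card V choose s)"
  obtains C where "\<And>U. U \<subseteq> V \<Longrightarrow> \<forall>S\<in>\<B>. \<not> S \<subseteq> U \<Longrightarrow>
    \<exists>W\<subseteq>U. card W \<le> s \<and> U \<subseteq> C W \<and> C W \<subseteq> V \<and>
      real (card (C W)) \<le> (1 - d / (2 * real s)) * real (card V)"
proof
  define C where "C = (\<lambda>W. V - {v \<in> V - W. heavy V \<B> s d (insert v W)})"
  fix U assume U: "U \<subseteq> V" and indep: "\<forall>S\<in>\<B>. \<not> S \<subseteq> U"
  have fU: "finite U" using U V finite_subset by blast
  define F where "F = {W. W \<subseteq> U \<and> card W \<le> s \<and> heavy V \<B> s d W}"
  have finF: "finite F" unfolding F_def using fU by simp
  have "{} \<in> F" using dense by (simp add: F_def heavy_def)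
  then have "Max (card ` F) \<in> card ` F" using finF by (intro Max_in) auto
  then obtain W where W: "W \<in> F" and "card W = Max (card ` F)" by auto
  then have maxW: "\<And>X. X \<in> F \<Longrightarrow> card X \<le> card W" using finF by simp
  have fW: "finite W" using W fU finite_subset by (auto simp: F_def)
  have "card W \<noteq> s"
  proof
    assume c: "card W = s"
    then have "card {S \<in> \<B>. W \<subseteq> S} \<noteq> 0" using W s by (simp add: F_def heavy_def)
    then have "{S \<in> \<B>. W \<subseteq> S} \<noteq> {}" by (metis card.empty)
    then obtain S where S: "S \<in> \<B>" "W \<subseteq> S" by auto
    then have "S \<subseteq> V" "card S = s" using B by auto
    then have "finite S" using V(1) finite_subset by blast
    then have "W = S" using S(2) c \<open>card S = s\<close> card_subset_eq by metis
    then show False using S W indep by (auto simp: F_def)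
  qed
  then have cW: "card W < s" using W by (auto simp: F_def)
  have "U \<subseteq> C W"
  proof
    fix v assume v: "v \<in> U"
    have "\<not> heavy V \<B> s d (insert v W)" if "v \<notin> W"
    proof
      assume "heavy V \<B> s d (insert v W)"
      then have "insert v W \<in> F" using v W that cW fW by (auto simp: F_def)
      from maxW[OF this] that fW show False by simp
    qed
    then show "v \<in> C W" using v U by (auto simp: C_def)
  qed
  moreover have "real (card (C W)) \<le> (1 - d / (2 * real s)) * real (card V)"
  proof -
    let ?H = "{v \<in> V - W. heavy V \<B> s d (insert v W)}"
    have "W \<subseteq> V" "heavy V \<B> s d W" using W U by (auto simp: F_def)
    then have "real (card ?H) \<ge> d / (2 * real s) * real (card V)"
      using many_heavy_extensions[OF V _ B cW s(2) d] by blast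
    moreover have "card (C W) = card V - card ?H"
      unfolding C_def using V by (intro card_Diff_subset) auto
    moreover have "card ?H \<le> card V" using V by (intro card_mono) auto
    ultimately show ?thesis by (simp add: algebra_simps of_nat_diff)
  qed
  moreover have "C W \<subseteq> V" by (auto simp: C_def)
  ultimately show "\<exists>W\<subseteq>U. card W \<le> s \<and> U \<subseteq> C W \<and> C W \<subseteq> V \<and>
      real (card (C W)) \<le> (1 - d / (2 * real s)) * real (card V)"
    using W by (auto simp: F_def)
qed

section \<open>Induced subgraphs and distance\<close>

lemma is_graph_induced: "is_graph G \<Longrightarrow> U \<subseteq> verts G \<Longrightarrow> is_graph (induced G U)"
  by (auto simp: is_graph_def induced_def intro: finite_subset)

lemma verts_induced [simp]: "verts (induced G U) = U"
  by (simp add: induced_def)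

lemma induced_induced: "S \<subseteq> U \<Longrightarrow> induced (induced G U) S = induced G S"
  by (auto simp: induced_def)

lemma far_antimono: "far \<epsilon> G P \<Longrightarrow> \<delta> \<le> \<epsilon> \<Longrightarrow> far \<delta> G P"
  unfolding far_def by (meson ereal_less_eq(3) order_le_less_trans)

lemma not_mem_if_far:
  assumes "far \<epsilon> G P" "0 < \<epsilon>"
  shows "G \<notin> P"
proof
  assume "G \<in> P"
  then have "property_dist G P \<le> ereal (graph_dist G G)"
    unfolding property_dist_def by (intro INF_lower) auto
  then have "property_dist G P \<le> ereal 0" by (simp add: graph_dist_def)
  moreover have "ereal \<epsilon> < property_dist G P" using assms by (simp add: far_def)
  ultimately have "ereal \<epsilon> < ereal 0" by (rule less_le_trans[rotated])
  then show False using assms by simp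
qed

section \<open>From testers to containers\<close>

text \<open>The tester accepts with probability one and every sample has positive probability, so no sample
  may lead to rejection.\<close>

lemma one_sided_canonical_accepts_members:
  assumes T: "one_sided_canonical_tester P s D" "0 < \<epsilon>"
    and G: "input_graph G" "G \<in> P" and S: "S \<subseteq> verts G" "card S = min (s \<epsilon>) (card (verts G))"
  shows "induced G S \<in> D \<epsilon>"
proof -
  let ?X = "{S. S \<subseteq> verts G \<and> card S = min (s \<epsilon>) (card (verts G))}"
  have "finite ?X" using G by (simp add: input_graph_def is_graph_def)
  moreover have "S \<in> ?X" using S by simp
  ultimately have "S \<in> set_pmf (vertex_sample G (s \<epsilon>))"
    unfolding vertex_sample_def by (subst set_pmf_of_set) auto
  moreover have "measure_pmf.prob (vertex_sample G (s \<epsilon>)) {S. induced G S \<in> D \<epsilon>} = 1"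
    using T G unfolding one_sided_canonical_tester_def by blast
  then have "AE S in measure_pmf (vertex_sample G (s \<epsilon>)). induced G S \<in> D \<epsilon>"
    by (subst (asm) measure_pmf.prob_eq_1) auto
  ultimately show ?thesis by (auto simp: AE_measure_pmf_iff)
qed

text \<open>The hypergraph consists of the rejected \<open>s\<close>-sets; it has density at least \<open>2/3\<close> because \<open>G\<close> is
  far, and \<open>d = 1/2\<close> leaves room for the strict inequality. One-sidedness makes every \<open>U\<close> with
  \<open>G[U]\<close> in \<open>P\<close> independent: if a rejected \<open>S\<close> were contained in \<open>U\<close>, then \<open>G[S]\<close> would be in \<open>P\<close>
  by heredity, and the tester run on \<open>G[S]\<close> samples the whole graph \<open>G[S]\<close> and rejects it.

  The hypergraph argument needs \<open>s > 0\<close>. If \<open>s = 0\<close>, the tester sees only the empty graph, so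
  it cannot both reject a far graph and accept some nonempty member of \<open>P\<close>; then the empty set is the
  only one to be covered.\<close>

lemma canonical_tester_imp_container:
  assumes her: "hereditary_property P" and T: "one_sided_canonical_tester P s D"
    and e: "0 < \<delta>" "\<delta> \<le> \<epsilon>"
  shows "ordered_container_lemma P \<epsilon> (if s \<delta> = 0 then 1 else 1 / (4 * real (s \<delta>))) (2 * s \<delta>) (s \<delta>)"
proof -
  define k where "k = s \<delta>"
  define \<eta> where "\<eta> = (if k = 0 then 1 else 1 / (4 * real k))"
  have "\<exists>f C. f \<in> members_in P G \<rightarrow> {xs. distinct xs \<and> set xs \<subseteq> verts G \<and> length xs \<le> k}
          \<and> C \<in> f ` members_in P G \<rightarrow>
              {W. W \<subseteq> verts G \<and> real (card W) \<le> (1 - \<eta>) * real (card (verts G))}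
          \<and> (\<forall>U\<in>members_in P G. set (f U) \<subseteq> U \<and> U \<subseteq> C (f U))"
    if G: "is_graph G" and n: "2 * k \<le> card (verts G)" and far: "far \<epsilon> G P" for G
  proof -
    let ?V = "verts G"
    have fV: "finite ?V" using G by (simp add: is_graph_def)
    have farD: "measure_pmf.prob (vertex_sample G k) {S. induced G S \<notin> D \<delta>} \<ge> 2/3" if "?V \<noteq> {}"
      using T e G that far_antimono[OF far e(2)]
      unfolding one_sided_canonical_tester_def input_graph_def k_def by blast
    show ?thesis
    proof (cases "k = 0")
      case True
      have "U = {}" if U: "U \<in> members_in P G" for U
      proof (rule ccontr)
        assume ne: "U \<noteq> {}"
        have UV: "U \<subseteq> ?V" "induced G U \<in> P" using U by (auto simp: members_in_def)
        have "input_graph (induced G U)" using ne is_graph_induced[OF G UV(1)]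
          by (simp add: input_graph_def)
        then have "induced (induced G U) {} \<in> D \<delta>"
          using one_sided_canonical_accepts_members[OF T e(1) _ UV(2), of "{}"] True
          by (simp add: k_def)
        then have D: "induced G {} \<in> D \<delta>" by (simp add: induced_induced)
        have "{S. S \<subseteq> ?V \<and> card S = 0} = {{}}" using fV finite_subset by fastforce
        then have "vertex_sample G k = return_pmf {}"
          using True by (simp add: vertex_sample_def pmf_of_set_singleton)
        then show False using farD D UV ne by (auto simp: indicator_def)
      qed
      then show ?thesis
        using True by (intro exI[of _ "\<lambda>_. []"] exI[of _ "\<lambda>_. {}"]) (auto simp: \<eta>_def)
    next
      case False
      then have k: "0 < k" and ne: "?V \<noteq> {}" using n by auto
      let ?X = "{S. S \<subseteq> ?V \<and> card S = k}"
      define \<B> where "\<B> = {S \<in> ?X. induced G S \<notin> D \<delta>}"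
      have X: "finite ?X" "?X \<noteq> {}" "card ?X = card ?V choose k"
        using fV n k obtain_subset_with_card_n[of k ?V] by (auto simp: n_subsets)
      have "vertex_sample G k = pmf_of_set ?X"
        using n by (simp add: vertex_sample_def min_def)
      then have "real (card (?X \<inter> {S. induced G S \<notin> D \<delta>})) / real (card ?X) \<ge> 2/3"
        using farD[OF ne] measure_pmf_of_set[OF X(2,1)] by simp
      moreover have "?X \<inter> {S. induced G S \<notin> D \<delta>} = \<B>" by (auto simp: \<B>_def)
      moreover have pos: "0 < real (card ?V choose k)" using n by simp
      ultimately have "2 * real (card ?V choose k) \<le> 3 * real (card \<B>)"
        using X(3) by (simp add: divide_simps)
      then have dense: "real (card \<B>) > 1/2 * real (card ?V choose k)" using pos by linarith
      obtain C where C: "\<And>U. U \<subseteq> ?V \<Longrightarrow> \<forall>S\<in>\<B>. \<not> S \<subseteq> U \<Longrightarrow>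
          \<exists>W\<subseteq>U. card W \<le> k \<and> U \<subseteq> C W \<and> C W \<subseteq> ?V \<and>
            real (card (C W)) \<le> (1 - (1/2) / (2 * real k)) * real (card ?V)"
        by (rule dense_hypergraph_containers[OF fV _ k n _ dense]) (auto simp: \<B>_def)
      have "\<exists>W\<subseteq>U. card W \<le> k \<and> U \<subseteq> C W \<and> C W \<subseteq> ?V \<and>
            real (card (C W)) \<le> (1 - \<eta>) * real (card ?V)" if U: "U \<in> members_in P G" for U
      proof -
        have UV: "U \<subseteq> ?V" "induced G U \<in> P" using U by (auto simp: members_in_def)
        have "\<not> S \<subseteq> U" if S: "S \<in> \<B>" for S
        proof
          assume SU: "S \<subseteq> U"
          have SV: "S \<subseteq> ?V" "card S = k" "induced G S \<notin> D \<delta>" using S by (auto simp: \<B>_def)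
          have "induced (induced G U) S \<in> P"
            using her UV SU by (simp add: hereditary_property_def)
          then have "induced G S \<in> P" using SU by (simp add: induced_induced)
          moreover have "input_graph (induced G S)"
            using is_graph_induced[OF G SV(1)] SV k by (auto simp: input_graph_def)
          ultimately have "induced (induced G S) S \<in> D \<delta>"
            using SV by (intro one_sided_canonical_accepts_members[OF T e(1)]) (auto simp: k_def)
          then show False using SV by (simp add: induced_induced)
        qed
        then show ?thesis using C[OF UV(1)] False by (simp add: \<eta>_def)
      qed
      then obtain w where w: "\<And>U. U \<in> members_in P G \<Longrightarrow> w U \<subseteq> U \<and> card (w U) \<le> k \<and> U \<subseteq> C (w U) \<and> C (w U) \<subseteq> ?V \<and>
            real (card (C (w U))) \<le> (1 - \<eta>) * real (card ?V)" by metis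
      have sub: "w U \<subseteq> ?V" if "U \<in> members_in P G" for U
        using w[OF that] that by (auto simp: members_in_def)
      have fin: "finite (w U)" if "U \<in> members_in P G" for U
        by (rule finite_subset[OF sub[OF that] fV])
      show ?thesis
        using w fin sub by (intro exI[of _ "\<lambda>U. sorted_list_of_set (w U)"] exI[of _ "\<lambda>xs. C (set xs)"])
          (auto simp: image_iff Pi_iff)
    qed
  qed
  moreover have "0 < \<eta>" by (simp add: \<eta>_def)
  ultimately show ?thesis using e unfolding ordered_container_lemma_def \<eta>_def k_def by auto
qed

text \<open>The convention bounds the sample size at \<open>\<delta>\<close> by \<open>Q (c\<^sub>0 \<delta>)\<close>. Since \<open>c\<close> has to be smaller than 1
  whatever \<open>c\<^sub>0\<close> is, the canonical tester is used at \<open>\<delta> = c \<epsilon> / c\<^sub>0 \<le> \<epsilon>\<close>, where the bound reads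
  \<open>Q (c \<epsilon>)\<close>; a graph that is \<open>\<epsilon>\<close>-far is also \<open>\<delta>\<close>-far.\<close>

lemma tester_imp_container:
  fixes c\<^sub>0 K\<^sub>0 :: real
  assumes "0 < c\<^sub>0" "0 < K\<^sub>0"
  shows "\<exists>c K :: real. 0 < c \<and> c < 1 \<and> 0 < K \<and>
       (\<forall>(P :: graph set) (Q :: real \<Rightarrow> nat).
          hereditary_property P \<and> canonicalization_convention c\<^sub>0 K\<^sub>0 P Q
          \<and> admits_one_sided_tester P {0<..<1} (\<lambda>\<epsilon>. real (Q \<epsilon>)) \<longrightarrow>
          (\<exists>(\<eta> :: real \<Rightarrow> real) (N :: real \<Rightarrow> nat) (q :: real \<Rightarrow> nat). \<forall>\<epsilon>>0.
             ordered_container_lemma P \<epsilon> (\<eta> \<epsilon>) (N \<epsilon>) (q \<epsilon>)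
             \<and> (c * \<epsilon> < 1 \<longrightarrow>
                  real (q \<epsilon>) \<le> K * real (Q (c * \<epsilon>))
                  \<and> \<eta> \<epsilon> \<ge> inverse (real (Q (c * \<epsilon>))) / K
                  \<and> real (N \<epsilon>) \<le> K * real (Q (c * \<epsilon>)))))"
proof -
  define c where "c = min c\<^sub>0 (1/2)"
  define K where "K = max 1 (4 * K\<^sub>0)"
  have c: "0 < c" "c < 1" "c \<le> c\<^sub>0" and K: "1 \<le> K" "4 * K\<^sub>0 \<le> K"
    using assms by (auto simp: c_def K_def)
  show ?thesis
  proof (rule exI[of _ c], rule exI[of _ K], intro conjI allI impI)
    fix P Q assume A: "hereditary_property P \<and> canonicalization_convention c\<^sub>0 K\<^sub>0 P Q
          \<and> admits_one_sided_tester P {0<..<1} (\<lambda>\<epsilon>. real (Q \<epsilon>))"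
    then obtain s D where T: "one_sided_canonical_tester P s D"
      and sQ: "\<And>\<epsilon>. 0 < \<epsilon> \<Longrightarrow> c\<^sub>0 * \<epsilon> < 1 \<Longrightarrow> real (s \<epsilon>) \<le> K\<^sub>0 * real (Q (c\<^sub>0 * \<epsilon>))"
      by (auto simp: canonicalization_convention_def)
    define \<sigma> where "\<sigma> = (\<lambda>\<epsilon>. s (c * \<epsilon> / c\<^sub>0))"
    define \<eta> where "\<eta> = (\<lambda>\<epsilon>. if \<sigma> \<epsilon> = 0 then 1 else 1 / (4 * real (\<sigma> \<epsilon>)))"
    have main: "ordered_container_lemma P \<epsilon> (\<eta> \<epsilon>) (2 * \<sigma> \<epsilon>) (\<sigma> \<epsilon>)
       \<and> (c * \<epsilon> < 1 \<longrightarrow>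
          real (\<sigma> \<epsilon>) \<le> K * real (Q (c * \<epsilon>))
          \<and> (\<eta> \<epsilon>) \<ge> inverse (real (Q (c * \<epsilon>))) / K
          \<and> real (2 * \<sigma> \<epsilon>) \<le> K * real (Q (c * \<epsilon>)))" if e: "\<epsilon> > 0" for \<epsilon>
    proof (intro conjI impI)
      have d: "0 < c * \<epsilon> / c\<^sub>0" "c * \<epsilon> / c\<^sub>0 \<le> \<epsilon>" "c\<^sub>0 * (c * \<epsilon> / c\<^sub>0) = c * \<epsilon>"
        using c e assms by (auto simp: divide_le_eq)
      show "ordered_container_lemma P \<epsilon> (\<eta> \<epsilon>) (2 * \<sigma> \<epsilon>) (\<sigma> \<epsilon>)"
        unfolding \<sigma>_def \<eta>_def using A by (intro canonical_tester_imp_container[OF _ T d(1,2)]) auto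
      assume "c * \<epsilon> < 1"
      then have "real (\<sigma> \<epsilon>) \<le> K\<^sub>0 * real (Q (c * \<epsilon>))"
        using sQ[OF d(1)] d(3) by (simp add: \<sigma>_def)
      moreover have "4 * K\<^sub>0 * real (Q (c * \<epsilon>)) \<le> K * real (Q (c * \<epsilon>))"
        using K by (intro mult_right_mono) auto
      ultimately have b: "4 * real (\<sigma> \<epsilon>) \<le> K * real (Q (c * \<epsilon>))" by linarith
      then show "real (\<sigma> \<epsilon>) \<le> K * real (Q (c * \<epsilon>))" "real (2 * \<sigma> \<epsilon>) \<le> K * real (Q (c * \<epsilon>))"
        by auto
      show "(\<eta> \<epsilon>) \<ge> inverse (real (Q (c * \<epsilon>))) / K"
      proof (cases "\<sigma> \<epsilon> = 0")
        case True
        have "inverse (real (Q (c * \<epsilon>))) \<le> 1"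
          by (cases "Q (c * \<epsilon>) = 0") (auto simp: inverse_eq_divide)
        then show ?thesis using True K by (simp add: \<eta>_def divide_le_eq)
      next
        case False
        then have "1 / (K * real (Q (c * \<epsilon>))) \<le> 1 / (4 * real (\<sigma> \<epsilon>))"
          using b by (intro divide_left_mono) auto
        then show ?thesis using False by (simp add: \<eta>_def inverse_eq_divide mult.commute)
      qed
    qed
    show "\<exists>(\<eta> :: real \<Rightarrow> real) (N :: real \<Rightarrow> nat) (q :: real \<Rightarrow> nat). \<forall>\<epsilon>>0.
             ordered_container_lemma P \<epsilon> (\<eta> \<epsilon>) (N \<epsilon>) (q \<epsilon>)
             \<and> (c * \<epsilon> < 1 \<longrightarrow>
                  real (q \<epsilon>) \<le> K * real (Q (c * \<epsilon>))
                  \<and> \<eta> \<epsilon> \<ge> inverse (real (Q (c * \<epsilon>))) / K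
                  \<and> real (N \<epsilon>) \<le> K * real (Q (c * \<epsilon>)))"
      by (rule_tac x = \<eta> in exI, rule_tac x = "\<lambda>\<epsilon>. 2 * \<sigma> \<epsilon>" in exI, rule_tac x = \<sigma> in exI)
        (intro allI impI main)
  qed (use c K in auto)
qed

section \<open>The sampling algorithm\<close>

lemma replicate_pmf_of_set:
  assumes A: "finite A" "A \<noteq> {}"
  shows "replicate_pmf m (pmf_of_set A) = pmf_of_set {xs. set xs \<subseteq> A \<and> length xs = m}"
proof (induction m)
  case 0
  have "{xs. set xs \<subseteq> A \<and> length xs = 0} = {[]}" by auto
  then show ?case by (simp add: pmf_of_set_singleton)
next
  case (Suc m)
  let ?L = "\<lambda>m. {xs. set xs \<subseteq> A \<and> length xs = m}"
  have fin: "finite (?L k)" for k by (rule finite_lists_length_eq[OF A(1)])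
  have ne: "?L k \<noteq> {}" for k
  proof -
    obtain a where "a \<in> A" using A by auto
    then have "replicate k a \<in> ?L k" by auto
    then show ?thesis by blast
  qed
  have "pmf (replicate_pmf (Suc m) (pmf_of_set A)) xs = pmf (pmf_of_set (?L (Suc m))) xs" for xs
  proof (cases xs)
    case Nil
    then have "xs \<notin> set_pmf (replicate_pmf (Suc m) (pmf_of_set A))"
      "xs \<notin> set_pmf (pmf_of_set (?L (Suc m)))"
      by (simp_all only: set_replicate_pmf set_pmf_of_set[OF ne fin]) auto
    from this[THEN pmf_eq_0_set_pmf[THEN iffD2]] show ?thesis by (rule trans[OF _ sym])
  next
    case (Cons y ys)
    let ?f = "\<lambda>(x, xs). x # xs"
    have "replicate_pmf (Suc m) (pmf_of_set A)
        = map_pmf ?f (pair_pmf (pmf_of_set A) (replicate_pmf m (pmf_of_set A)))"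
      by (simp add: pair_pmf_def map_bind_pmf)
    moreover have "inj ?f" by (auto simp: inj_def)
    ultimately have "pmf (replicate_pmf (Suc m) (pmf_of_set A)) (?f (y, ys))
        = pmf (pair_pmf (pmf_of_set A) (replicate_pmf m (pmf_of_set A))) (y, ys)"
      using pmf_map_inj'[of ?f _ "(y, ys)"] by metis
    then have "pmf (replicate_pmf (Suc m) (pmf_of_set A)) (y # ys)
        = pmf (pmf_of_set A) y * pmf (pmf_of_set (?L m)) ys"
      by (simp only: pmf_pair Suc.IH prod.case)
    also have "\<dots> = pmf (pmf_of_set (?L (Suc m))) (y # ys)"
      using A fin ne by (simp add: pmf_of_set card_lists_length_eq indicator_def del: Collect_empty_eq)
    finally show ?thesis using Cons by simp
  qed
  then show ?case by (rule pmf_eqI)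
qed

primrec sample_list :: "nat \<Rightarrow> (nat list \<Rightarrow> oracle_alg) \<Rightarrow> oracle_alg" where
  "sample_list 0 k = k []"
| "sample_list (Suc m) k = Sample (\<lambda>v. sample_list m (\<lambda>vs. k (v # vs)))"

lemma run_sample_list:
  "run G (sample_list m k) = bind_pmf (replicate_pmf m (pmf_of_set (verts G)))
     (\<lambda>vs. map_pmf (\<lambda>(b, r, s). (b, r, s + m)) (run G (k vs)))"
proof (induction m arbitrary: k)
  case 0
  show ?case by (simp add: bind_return_pmf case_prod_unfold)
next
  case (Suc m)
  show ?case
    by (simp add: Suc.IH bind_assoc_pmf bind_return_pmf map_bind_pmf pmf.map_comp o_def case_prod_unfold)
qed

lemma queries_sampled_sample_list:
  "(\<And>vs. queries_sampled (X \<union> set vs) (k vs)) \<Longrightarrow> queries_sampled X (sample_list m k)"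
proof (induction m arbitrary: X k)
  case 0
  from 0[of "[]"] show ?case by simp
next
  case (Suc m)
  have "queries_sampled (insert v X) (sample_list m (\<lambda>vs. k (v # vs)))" for v
    using Suc.prems[of "v # _"] by (intro Suc.IH) simp
  then show ?case by simp
qed

primrec query_list :: "(nat \<times> nat) list \<Rightarrow> nat set set \<Rightarrow> (nat set set \<Rightarrow> bool) \<Rightarrow> oracle_alg" where
  "query_list [] E d = Halt (d E)"
| "query_list (p # ps) E d =
     Query (fst p) (snd p) (\<lambda>b. query_list ps (if b then insert {fst p, snd p} E else E) d)"

lemma run_query_list:
  "run G (query_list ps E d)
   = return_pmf (d (E \<union> {{u, v} | u v. (u, v) \<in> set ps \<and> {u, v} \<in> edges G}), length ps, 0)"
proof (induction ps arbitrary: E)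
  case Nil
  show ?case by simp
next
  case (Cons p ps)
  have "(if {fst p, snd p} \<in> edges G then insert {fst p, snd p} E else E)
          \<union> {{u, v} | u v. (u, v) \<in> set ps \<and> {u, v} \<in> edges G}
      = E \<union> {{u, v} | u v. (u, v) \<in> set (p # ps) \<and> {u, v} \<in> edges G}"
    by (cases p) auto
  then show ?case using Cons by simp
qed

lemma queries_sampled_query_list:
  "set ps \<subseteq> X \<times> X \<Longrightarrow> queries_sampled X (query_list ps E d)"
  by (induction ps arbitrary: E) auto

text \<open>All ordered pairs of samples are queried, equal ones included; a pair of equal labels is never
  an edge. Repeated samples are harmless because only the set of sampled vertices matters.\<close>

definition sampling_tester :: "graph set \<Rightarrow> nat \<Rightarrow> oracle_alg" where
  "sampling_tester P m =
     sample_list m (\<lambda>vs. query_list (List.product vs vs) {} (\<lambda>E. (set vs, E) \<in> P))"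

lemma queries_sampled_sampling_tester: "queries_sampled {} (sampling_tester P m)"
  unfolding sampling_tester_def
  by (intro queries_sampled_sample_list queries_sampled_query_list) auto

lemma run_sampling_tester:
  assumes "is_graph G"
  shows "run G (sampling_tester P m)
    = map_pmf (\<lambda>vs. (induced G (set vs) \<in> P, m * m, m)) (replicate_pmf m (pmf_of_set (verts G)))"
proof -
  have eq: "(set vs, {{u, v} | u v. (u, v) \<in> set (List.product vs vs) \<and> {u, v} \<in> edges G})
      = induced G (set vs)" for vs
  proof -
    have "\<exists>u v. e = {u, v} \<and> (u, v) \<in> set vs \<times> set vs \<and> {u, v} \<in> edges G"
      if "e \<in> edges G" "e \<subseteq> set vs" for e
      using assms that by (fastforce simp: is_graph_def card_2_iff)
    then show ?thesis by (auto simp: induced_def)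
  qed
  have "run G (sampling_tester P m) = bind_pmf (replicate_pmf m (pmf_of_set (verts G)))
      (\<lambda>vs. return_pmf (induced G (set vs) \<in> P, length vs * length vs, m))"
    unfolding sampling_tester_def run_sample_list run_query_list
    by (simp add: eq[simplified])
  also have "\<dots> = bind_pmf (replicate_pmf m (pmf_of_set (verts G)))
      (\<lambda>vs. return_pmf (induced G (set vs) \<in> P, m * m, m))"
    by (intro bind_pmf_cong) (auto simp: set_replicate_pmf)
  finally show ?thesis by (simp add: map_pmf_def)
qed

lemma accept_prob_sampling_tester:
  assumes "input_graph G" "G \<in> P" "hereditary_property P"
  shows "accept_prob G (sampling_tester P m) = 1"
proof -
  have G: "is_graph G" "finite (verts G)" "verts G \<noteq> {}"
    using assms by (auto simp: input_graph_def is_graph_def)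
  have "induced G (set vs) \<in> P" if "vs \<in> set_pmf (replicate_pmf m (pmf_of_set (verts G)))" for vs
    using that assms(2,3) G unfolding hereditary_property_def by (auto simp: set_replicate_pmf lists_eq_set)
  then show ?thesis unfolding accept_prob_def run_sampling_tester[OF G(1)]
    by (subst measure_pmf.prob_eq_1) (auto simp: AE_measure_pmf_iff)
qed

lemma reject_prob_sampling_tester:
  assumes "input_graph G"
  shows "reject_prob G (sampling_tester P m)
    = 1 - real (card {vs. set vs \<subseteq> verts G \<and> length vs = m \<and> induced G (set vs) \<in> P})
          / real (card (verts G)) ^ m"
proof -
  have G: "is_graph G" "finite (verts G)" "verts G \<noteq> {}"
    using assms by (auto simp: input_graph_def is_graph_def)
  let ?L = "{xs. set xs \<subseteq> verts G \<and> length xs = m}"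
  let ?A = "{vs. induced G (set vs) \<in> P}"
  obtain v where "v \<in> verts G" using G by auto
  then have "replicate m v \<in> ?L" by auto
  then have L: "?L \<noteq> {}" "finite ?L" "card ?L = card (verts G) ^ m"
    using G by (blast, auto simp: finite_lists_length_eq card_lists_length_eq)
  have "reject_prob G (sampling_tester P m) = measure_pmf.prob (pmf_of_set ?L) (- ?A)"
    unfolding reject_prob_def run_sampling_tester[OF G(1)] replicate_pmf_of_set[OF G(2,3)] measure_map_pmf
    by (rule arg_cong[where f = "measure_pmf.prob _"]) auto
  also have "\<dots> = 1 - measure_pmf.prob (pmf_of_set ?L) ?A"
    using measure_pmf.prob_compl[of ?A "pmf_of_set ?L"] by (simp add: Compl_eq_Diff_UNIV)
  also have "measure_pmf.prob (pmf_of_set ?L) ?A = real (card (?L \<inter> ?A)) / real (card (verts G)) ^ m"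
    using measure_pmf_of_set[OF L(1,2)] L(3) by simp
  also have "?L \<inter> ?A = {vs. set vs \<subseteq> verts G \<and> length vs = m \<and> induced G (set vs) \<in> P}" by auto
  finally show ?thesis .
qed

section \<open>The probability of missing a violation\<close>

text \<open>A list is determined by its entries outside the positions \<open>is\<close>, where it has at most \<open>|C|\<close>
  choices each.\<close>

lemma card_lists_fixed_positions:
  assumes "finite C" "set is \<subseteq> {..<m}" "distinct is"
  shows "card {xs. set xs \<subseteq> C \<and> length xs = m \<and> map ((!) xs) is = ys} \<le> card C ^ (m - length is)"
proof -
  let ?Z = "{xs. set xs \<subseteq> C \<and> length xs = m \<and> map ((!) xs) is = ys}"
  let ?J = "{..<m} - set is"
  let ?r = "\<lambda>xs. restrict ((!) xs) ?J"
  have "inj_on ?r ?Z"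
  proof (rule inj_onI)
    fix xs zs assume x: "xs \<in> ?Z" and z: "zs \<in> ?Z" and eq: "?r xs = ?r zs"
    show "xs = zs"
    proof (rule nth_equalityI)
      show "length xs = length zs" using x z by simp
      fix i assume "i < length xs"
      then have i: "i < m" using x by simp
      show "xs ! i = zs ! i"
      proof (cases "i \<in> set is")
        case True
        have "map ((!) xs) is = map ((!) zs) is" using x z by simp
        then show ?thesis using True by (simp add: map_eq_conv)
      next
        case False
        then show ?thesis using fun_cong[OF eq, of i] i by simp
      qed
    qed
  qed
  moreover have "?r ` ?Z \<subseteq> (\<Pi>\<^sub>E i\<in>?J. C)"
  proof
    fix g assume "g \<in> ?r ` ?Z"
    then obtain xs where xs: "g = ?r xs" "set xs \<subseteq> C" "length xs = m" by auto
    have "xs ! i \<in> C" if "i < m" for i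
      using that xs(2,3) nth_mem[of i xs] by blast
    then show "g \<in> (\<Pi>\<^sub>E i\<in>?J. C)" unfolding xs(1) by (intro restrict_PiE_iff[THEN iffD2]) simp
  qed
  moreover have "finite (\<Pi>\<^sub>E i\<in>?J. C)" using assms(1) by (intro finite_PiE) auto
  ultimately have "card ?Z \<le> card (\<Pi>\<^sub>E i\<in>?J. C)" by (rule card_inj_on_le)
  also have "\<dots> = card C ^ (m - length is)"
    using assms by (simp add: card_PiE card_Diff_subset distinct_card)
  finally show ?thesis .
qed

text \<open>Union bound over fingerprints. If the entries of \<open>xs\<close> form a member \<open>U\<close> of \<open>M\<close>, the fingerprint
  \<open>f U\<close> appears in \<open>xs\<close> at some list of at most \<open>q\<close> positions, and there are at most
  \<open>\<Sum>i\<le>q. m ^ i\<close> such lists. Once the positions and the entries there are fixed, the container is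
  determined, and each of the at least \<open>m - q\<close> other entries lies in it, which costs a factor
  \<open>1 - \<eta>\<close> each.\<close>

lemma containers_capture_few_lists:
  fixes f :: "'a set \<Rightarrow> 'a list"
  assumes V: "finite V" and \<eta>: "0 \<le> \<eta>" "\<eta> \<le> 1" and q: "q \<le> m"
    and f: "\<And>U. U \<in> M \<Longrightarrow> distinct (f U) \<and> set (f U) \<subseteq> U \<and> length (f U) \<le> q"
    and C: "\<And>U. U \<in> M \<Longrightarrow>
      U \<subseteq> C (f U) \<and> C (f U) \<subseteq> V \<and> real (card (C (f U))) \<le> (1 - \<eta>) * real (card V)"
  shows "real (card {xs. set xs \<subseteq> V \<and> length xs = m \<and> set xs \<in> M})
    \<le> (\<Sum>i\<le>q. real m ^ i) * (1 - \<eta>) ^ (m - q) * real (card V) ^ m"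
proof -
  define n where "n = real (card V)"
  define I where "I = {is. distinct is \<and> set is \<subseteq> {..<m} \<and> length is \<le> q}"
  define Y where "Y = (\<lambda>is :: nat list. {ys \<in> f ` M. length ys = length is})"
  define Z where "Z = (\<lambda>is ys. {xs. set xs \<subseteq> C ys \<and> length xs = m \<and> map ((!) xs) is = ys})"
  have fV: "set (f U) \<subseteq> V" if "U \<in> M" for U using f[OF that] C[OF that] by blast
  have I_sub: "I \<subseteq> {is. set is \<subseteq> {..<m} \<and> length is \<le> q}" by (auto simp: I_def)
  have finI: "finite I" by (rule finite_subset[OF I_sub]) (simp add: finite_lists_length_le)
  have cardI: "real (card I) \<le> (\<Sum>i\<le>q. real m ^ i)"
  proof -
    have "card I \<le> card {is. set is \<subseteq> {..<m} \<and> length is \<le> q}"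
      using I_sub by (intro card_mono) (simp_all add: finite_lists_length_le)
    also have "\<dots> = (\<Sum>i\<le>q. m ^ i)" by (simp add: card_lists_length_le)
    finally have "real (card I) \<le> real (\<Sum>i\<le>q. m ^ i)" by (simp only: of_nat_le_iff)
    then show ?thesis by simp
  qed
  have Y_sub: "Y is \<subseteq> {ys. set ys \<subseteq> V \<and> length ys = length is}" for "is"
    using fV by (auto simp: Y_def)
  have finY: "finite (Y is)" for "is"
    by (rule finite_subset[OF Y_sub]) (simp add: finite_lists_length_eq V)
  have cardY: "real (card (Y is)) \<le> n ^ length is" for "is"
  proof -
    have "card (Y is) \<le> card {ys. set ys \<subseteq> V \<and> length ys = length is}"
      using Y_sub V by (intro card_mono) (simp_all add: finite_lists_length_eq)
    also have "\<dots> = card V ^ length is" using V by (simp add: card_lists_length_eq)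
    finally show ?thesis unfolding n_def of_nat_power[symmetric] by (simp only: of_nat_le_iff)
  qed
  have n0: "0 \<le> (1 - \<eta>) * n" using \<eta> by (simp add: n_def)
  have cardZ: "real (card (Z is ys)) \<le> ((1 - \<eta>) * n) ^ (m - length is)" if i: "is \<in> I" and y: "ys \<in> Y is" for "is" ys
  proof -
    obtain U where U: "U \<in> M" "ys = f U" using y unfolding Y_def by blast
    have "finite (C ys)" using C[OF U(1)] U(2) V finite_subset by blast
    then have "card (Z is ys) \<le> card (C ys) ^ (m - length is)"
      unfolding Z_def using i y by (intro card_lists_fixed_positions) (auto simp: I_def)
    then have "real (card (Z is ys)) \<le> real (card (C ys)) ^ (m - length is)"
      unfolding of_nat_power[symmetric] by (simp only: of_nat_le_iff)
    also have "\<dots> \<le> ((1 - \<eta>) * n) ^ (m - length is)"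
      using C[OF U(1)] U(2) by (intro power_mono) (auto simp: n_def)
    finally show ?thesis .
  qed
  have sub: "{xs. set xs \<subseteq> V \<and> length xs = m \<and> set xs \<in> M} \<subseteq> (\<Union>is\<in>I. \<Union>ys\<in>Y is. Z is ys)"
  proof
    fix xs assume "xs \<in> {xs. set xs \<subseteq> V \<and> length xs = m \<and> set xs \<in> M}"
    then have xs: "set xs \<in> M" "length xs = m" by auto
    define ys where "ys = f (set xs)"
    have "\<forall>y\<in>set ys. \<exists>i<m. xs ! i = y"
      using f[OF xs(1)] xs(2) by (auto simp: ys_def in_set_conv_nth[symmetric] subset_iff)
    then obtain g where g: "\<And>y. y \<in> set ys \<Longrightarrow> g y < m \<and> xs ! g y = y" by metis
    have eq: "map ((!) xs) (map g ys) = ys" using g by (simp add: map_idI)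
    have "distinct (map g ys)"
      using eq f[OF xs(1)] by (metis distinct_map ys_def)
    then have "map g ys \<in> I" using g f[OF xs(1)] by (auto simp: I_def ys_def)
    moreover have "ys \<in> Y (map g ys)" using xs(1) by (simp add: Y_def ys_def)
    moreover have "xs \<in> Z (map g ys) ys"
      using eq C[OF xs(1)] xs(2) by (auto simp: Z_def ys_def)
    ultimately show "xs \<in> (\<Union>is\<in>I. \<Union>ys\<in>Y is. Z is ys)" by blast
  qed
  have finZ: "finite (Z is ys)" if "ys \<in> Y is" for "is" ys
  proof (rule finite_subset)
    show "Z is ys \<subseteq> {xs. set xs \<subseteq> V \<and> length xs = m}" using that C by (auto simp: Z_def Y_def)
  qed (simp add: finite_lists_length_eq V)
  have inner: "real (card (\<Union>ys\<in>Y is. Z is ys)) \<le> (1 - \<eta>) ^ (m - q) * n ^ m" if i: "is \<in> I" for "is"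
  proof -
    have l: "length is \<le> q" using i by (simp add: I_def)
    have "real (card (\<Union>ys\<in>Y is. Z is ys)) \<le> (\<Sum>ys\<in>Y is. real (card (Z is ys)))"
      unfolding of_nat_sum[symmetric] of_nat_le_iff by (rule card_UN_le[OF finY])
    also have "\<dots> \<le> (\<Sum>ys\<in>Y is. ((1 - \<eta>) * n) ^ (m - length is))"
      by (rule sum_mono) (rule cardZ[OF i])
    also have "\<dots> \<le> n ^ length is * ((1 - \<eta>) * n) ^ (m - length is)"
      using cardY n0 by (simp add: mult_right_mono)
    also have "\<dots> = (1 - \<eta>) ^ (m - length is) * n ^ m"
      using l q by (simp add: power_mult_distrib power_add[symmetric])
    also have "\<dots> \<le> (1 - \<eta>) ^ (m - q) * n ^ m"
      using \<eta> l by (intro mult_right_mono power_decreasing) (auto simp: n_def)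
    finally show ?thesis .
  qed
  have "card {xs. set xs \<subseteq> V \<and> length xs = m \<and> set xs \<in> M} \<le> card (\<Union>is\<in>I. \<Union>ys\<in>Y is. Z is ys)"
    by (rule card_mono[OF _ sub]) (use finI finY finZ in blast)
  also have "\<dots> \<le> (\<Sum>is\<in>I. card (\<Union>ys\<in>Y is. Z is ys))" by (rule card_UN_le[OF finI])
  finally have "real (card {xs. set xs \<subseteq> V \<and> length xs = m \<and> set xs \<in> M})
      \<le> (\<Sum>is\<in>I. real (card (\<Union>ys\<in>Y is. Z is ys)))"
    unfolding of_nat_sum[symmetric] of_nat_le_iff .
  also have "\<dots> \<le> (\<Sum>is\<in>I. (1 - \<eta>) ^ (m - q) * n ^ m)" by (rule sum_mono) (rule inner)
  also have "\<dots> \<le> (\<Sum>i\<le>q. real m ^ i) * ((1 - \<eta>) ^ (m - q) * n ^ m)"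
    using cardI \<eta> by (simp add: mult_right_mono n_def)
  finally show ?thesis by (simp add: n_def mult.assoc)
qed

lemma card_lists_missing_element:
  assumes V: "finite V"
  shows "card {xs. set xs \<subseteq> V \<and> length xs = m \<and> set xs \<noteq> V} \<le> card V * (card V - 1) ^ m"
proof -
  have "{xs. set xs \<subseteq> V \<and> length xs = m \<and> set xs \<noteq> V}
      \<subseteq> (\<Union>v\<in>V. {xs. set xs \<subseteq> V - {v} \<and> length xs = m})" by auto
  then have "card {xs. set xs \<subseteq> V \<and> length xs = m \<and> set xs \<noteq> V}
      \<le> card (\<Union>v\<in>V. {xs. set xs \<subseteq> V - {v} \<and> length xs = m})"
    by (intro card_mono) (use V in \<open>auto simp: finite_lists_length_eq\<close>)
  also have "\<dots> \<le> (\<Sum>v\<in>V. card {xs. set xs \<subseteq> V - {v} \<and> length xs = m})"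
    by (rule card_UN_le[OF V])
  also have "\<dots> = card V * (card V - 1) ^ m" using V by (simp add: card_lists_length_eq)
  finally show ?thesis .
qed

lemma one_minus_power_le_exp:
  fixes x :: real
  assumes "0 \<le> x" "x \<le> 1"
  shows "(1 - x) ^ k \<le> exp (- (x * real k))"
proof -
  have "(1 - x) ^ k \<le> exp (- x) ^ k"
    using assms exp_ge_add_one_self[of "- x"] by (intro power_mono) auto
  also have "\<dots> = exp (- (x * real k))" by (simp add: exp_of_nat_mult[symmetric] mult.commute)
  finally show ?thesis .
qed

lemma exp_minus_2_le: "exp (- 2 :: real) \<le> 1 / 3"
proof -
  have "1 + (2::real) \<le> exp 2" by (rule exp_ge_add_one_self)
  then show ?thesis by (simp add: exp_minus field_simps)
qed

text \<open>The left-hand side bounds the probability that \<open>m\<close> uniform samples miss some of \<open>n\<close> elements; the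
  hypothesis depends only on the upper bound \<open>N\<close> for \<open>n\<close>, since the algorithm does not know \<open>n\<close>.\<close>

lemma coupon_collector_bound:
  fixes N n m :: nat
  assumes n: "0 < n" "n \<le> N" and m: "real N * (ln (real N) + 2) \<le> real m"
  shows "real n * (1 - 1 / real n) ^ m \<le> 1 / 3"
proof -
  have N: "0 < real N" using n by simp
  have "(1 - 1 / real n) ^ m \<le> exp (- (1 / real n * real m))"
    using n by (intro one_minus_power_le_exp) auto
  also have "\<dots> \<le> exp (- (ln (real N) + 2))"
  proof -
    have "ln (real N) + 2 \<le> real m / real N" using m N by (simp add: field_simps)
    also have "\<dots> \<le> real m / real n" using n by (intro divide_left_mono) auto
    finally show ?thesis by simp
  qed
  also have "\<dots> = exp (- 2) / real N"
    using N by (simp add: exp_diff exp_minus field_simps)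
  finally have "real n * (1 - 1 / real n) ^ m \<le> real n * (exp (- 2) / real N)"
    using n by (intro mult_left_mono) auto
  also have "\<dots> = (real n / real N) * exp (- 2)" by simp
  also have "\<dots> \<le> 1 * exp (- 2)" using n by (intro mult_right_mono) auto
  finally show ?thesis using exp_minus_2_le by simp
qed

text \<open>With \<open>t = m / a\<close>, the logarithm of the left-hand side is at most
  \<open>(q + 1) (ln m + 1 - t)\<close>: one factor \<open>m\<close> pays for the number \<open>q + 1\<close> of summands, and the term 1 for
  the exponent \<open>m - q\<close> in place of \<open>m\<close>. As \<open>ln m = ln t + ln a\<close> and \<open>ln t \<le> t / 2\<close>, the bracket is
  at most \<open>-2\<close> as soon as \<open>t \<ge> 6 + 2 ln a\<close>.\<close>

lemma container_union_bound:
  fixes \<eta> :: real and q m :: nat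
  defines "a \<equiv> (real q + 1) / \<eta>"
  assumes \<eta>: "0 < \<eta>" "\<eta> \<le> 1" and m: "a * (6 + 2 * ln a) \<le> real m"
  shows "q \<le> m" "(\<Sum>i\<le>q. real m ^ i) * (1 - \<eta>) ^ (m - q) \<le> 1 / 3"
proof -
  have aq: "real q + 1 \<le> a" unfolding a_def using \<eta> by (simp add: le_divide_eq mult_left_le)
  then have a: "1 \<le> a" by linarith
  have "a * 6 \<le> a * (6 + 2 * ln a)" using a by (intro mult_left_mono) auto
  then have ma: "6 * a \<le> real m" using m by simp
  then show qm: "q \<le> m" using aq a by linarith
  have m1: "real q + 1 \<le> real m" "1 \<le> real m" using ma aq a by linarith+
  define t where "t = real m / a"
  have t: "0 < t" "real m = t * a" using m1 a by (auto simp: t_def)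
  have "6 + 2 * ln a \<le> t" using m a by (simp add: t_def field_simps)
  moreover have "ln t \<le> t / 2"
  proof -
    have "ln (t / 2) \<le> t / 2 - 1" using t by (intro ln_le_minus_one) auto
    moreover have "ln (2::real) \<le> 2 - 1" by (intro ln_le_minus_one) auto
    ultimately show ?thesis using t by (simp add: ln_div)
  qed
  moreover have "ln (real m) = ln t + ln a" using t a by (simp add: ln_mult)
  ultimately have key: "ln (real m) + 1 - t \<le> - 2" by linarith
  have "(\<Sum>i\<le>q. real m ^ i) \<le> (\<Sum>i\<le>q. real m ^ q)"
    using m1 by (intro sum_mono power_increasing) auto
  also have "\<dots> = (real q + 1) * real m ^ q" by simp
  also have "\<dots> \<le> real m * real m ^ q" using m1 by (intro mult_right_mono) auto
  also have "\<dots> = exp ((real q + 1) * ln (real m))"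
  proof -
    have "exp (real (Suc q) * ln (real m)) = real m ^ Suc q"
      using m1 by (subst exp_of_nat_mult) simp
    then show ?thesis by (simp add: add.commute)
  qed
  finally have s: "(\<Sum>i\<le>q. real m ^ i) \<le> exp ((real q + 1) * ln (real m))" .
  have "(1 - \<eta>) ^ (m - q) \<le> exp (- (\<eta> * real (m - q)))"
    using \<eta> by (intro one_minus_power_le_exp) auto
  also have "\<dots> \<le> exp ((real q + 1) * (1 - t))"
  proof -
    have "\<eta> * real m = (real q + 1) * t" using \<eta> a by (simp add: t_def a_def)
    moreover have "\<eta> * real q \<le> real q + 1"
      using mult_right_mono[OF \<eta>(2), of "real q"] by simp
    ultimately show ?thesis using qm by (simp add: of_nat_diff algebra_simps)
  qed
  finally have "(\<Sum>i\<le>q. real m ^ i) * (1 - \<eta>) ^ (m - q)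
      \<le> exp ((real q + 1) * ln (real m)) * exp ((real q + 1) * (1 - t))"
    using s \<eta> by (intro mult_mono) auto
  also have "\<dots> = exp ((real q + 1) * (ln (real m) + 1 - t))"
    by (simp add: exp_add[symmetric] algebra_simps)
  also have "\<dots> \<le> exp (- 2)"
  proof -
    have "(real q + 1) * (ln (real m) + 1 - t) \<le> (real q + 1) * (- 2)"
      using key by (intro mult_left_mono) auto
    also have "\<dots> \<le> - 2" by simp
    finally show ?thesis by simp
  qed
  finally show "(\<Sum>i\<le>q. real m ^ i) * (1 - \<eta>) ^ (m - q) \<le> 1 / 3" using exp_minus_2_le by linarith
qed

section \<open>From containers to testers\<close>

text \<open>The first summand lets the tester see every vertex of a graph with fewer than \<open>N\<close> vertices, the
  second one finds a violation in larger far graphs. If \<open>\<eta> > 1\<close>, containers would have negative size,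
  so no larger nonempty graph is far, unless the property is empty and every sample is rejected. The
  second summand must then vanish: for \<open>N = 0\<close> and large \<open>\<eta>\<close> the query bound is smaller than 1.\<close>

definition container_sample_size :: "nat \<Rightarrow> real \<Rightarrow> nat \<Rightarrow> nat" where
  "container_sample_size N \<eta> q =
     (if N = 0 then 0 else nat \<lceil>real N * (ln (real N) + 2)\<rceil>)
   + (if 1 < \<eta> then 0 else nat \<lceil>(real q + 1) / \<eta> * (6 + 2 * ln ((real q + 1) / \<eta>))\<rceil>)"

text \<open>A sample is accepted only if its vertices induce a member of \<open>P\<close>. In a graph with fewer than \<open>N\<close>
  vertices this requires missing a vertex, as a far graph is not in \<open>P\<close>; in a larger one it requires
  staying inside the container of the sample.\<close>

lemma sampling_tester_rejects_far:
  assumes P: "hereditary_property P" and cont: "ordered_container_lemma P \<epsilon> \<eta> N q"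
    and G: "input_graph G" and far: "far \<epsilon> G P"
  shows "reject_prob G (sampling_tester P (container_sample_size N \<eta> q)) \<ge> 2/3"
proof -
  define m where "m = container_sample_size N \<eta> q"
  define n where "n = card (verts G)"
  let ?A = "{vs. set vs \<subseteq> verts G \<and> length vs = m \<and> induced G (set vs) \<in> P}"
  have gr: "is_graph G" and V: "finite (verts G)" "verts G \<noteq> {}"
    using G by (auto simp: input_graph_def is_graph_def)
  then have n0: "0 < n" by (simp add: n_def card_gt_0_iff)
  have e: "0 < \<epsilon>" "0 < \<eta>" using cont by (auto simp: ordered_container_lemma_def)
  have "real (card ?A) / real n ^ m \<le> 1/3"
  proof (cases "P = {}")
    case True
    then show ?thesis by simp
  next
    case nonempty: False
    show ?thesis
    proof (cases "n < N")
      case True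
      have "induced G (verts G) = G" using gr by (auto simp: induced_def is_graph_def prod_eq_iff)
      then have "?A \<subseteq> {xs. set xs \<subseteq> verts G \<and> length xs = m \<and> set xs \<noteq> verts G}"
        using not_mem_if_far[OF far e(1)] by auto
      then have "card ?A \<le> card {xs. set xs \<subseteq> verts G \<and> length xs = m \<and> set xs \<noteq> verts G}"
        by (rule card_mono[rotated]) (rule finite_subset[OF _ finite_lists_length_eq[OF V(1), of m]], auto)
      also have "\<dots> \<le> n * (n - 1) ^ m"
        unfolding n_def by (rule card_lists_missing_element[OF V(1)])
      finally have "real (card ?A) \<le> real (n * (n - 1) ^ m)" by (simp only: of_nat_le_iff)
      also have "\<dots> = real n * (1 - 1 / real n) ^ m * real n ^ m"
      proof -
        have "real (n - 1) = (1 - 1 / real n) * real n" using n0 by (simp add: field_simps of_nat_diff)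
        then show ?thesis by (simp add: power_mult_distrib)
      qed
      finally have "real (card ?A) / real n ^ m \<le> real n * (1 - 1 / real n) ^ m"
        using n0 by (simp add: divide_le_eq)
      also have "\<dots> \<le> 1/3"
      proof (rule coupon_collector_bound)
        have "real N * (ln (real N) + 2) \<le> real (nat \<lceil>real N * (ln (real N) + 2)\<rceil>)"
          by (rule real_nat_ceiling_ge)
        also have "\<dots> \<le> real m" using True by (simp add: m_def container_sample_size_def)
        finally show "real N * (ln (real N) + 2) \<le> real m" .
      qed (use n0 True in auto)
      finally show ?thesis .
    next
      case False
      then obtain f C where f: "f \<in> members_in P G \<rightarrow> {xs. distinct xs \<and> set xs \<subseteq> verts G \<and> length xs \<le> q}"
        and C: "C \<in> f ` members_in P G \<rightarrow>
                {W. W \<subseteq> verts G \<and> real (card W) \<le> (1 - \<eta>) * real (card (verts G))}"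
        and fC: "\<forall>U\<in>members_in P G. set (f U) \<subseteq> U \<and> U \<subseteq> C (f U)"
        using cont gr far unfolding ordered_container_lemma_def n_def by (meson not_less)
      have \<eta>1: "\<eta> \<le> 1"
      proof (rule ccontr)
        assume "\<not> \<eta> \<le> 1"
        then have neg: "(1 - \<eta>) * real n < 0" using n0 by (simp add: mult_neg_pos)
        \<comment> \<open>A nonempty hereditary property contains the empty graph, so the empty set has a container.\<close>
        obtain H where H: "H \<in> P" using nonempty by auto
        then have "induced H {} \<in> P" "is_graph H"
          using P unfolding hereditary_property_def graph_property_def by blast+
        moreover have "induced H {} = induced G {}"
          using gr \<open>is_graph H\<close> by (force simp: induced_def is_graph_def)
        ultimately have "{} \<in> members_in P G" by (simp add: members_in_def)
        then have "real (card (C (f {}))) \<le> (1 - \<eta>) * real n" using C by (auto simp: n_def)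
        then show False using neg by linarith
      qed
      have ms: "(real q + 1) / \<eta> * (6 + 2 * ln ((real q + 1) / \<eta>)) \<le> real m"
      proof -
        have "(real q + 1) / \<eta> * (6 + 2 * ln ((real q + 1) / \<eta>))
            \<le> real (nat \<lceil>(real q + 1) / \<eta> * (6 + 2 * ln ((real q + 1) / \<eta>))\<rceil>)"
          by (rule real_nat_ceiling_ge)
        also have "\<dots> \<le> real m" using \<eta>1 by (simp add: m_def container_sample_size_def)
        finally show ?thesis .
      qed
      note ub = container_union_bound[OF e(2) \<eta>1 ms]
      have "?A = {vs. set vs \<subseteq> verts G \<and> length vs = m \<and> set vs \<in> members_in P G}"
        by (auto simp: members_in_def)
      then have "real (card ?A) \<le> (\<Sum>i\<le>q. real m ^ i) * (1 - \<eta>) ^ (m - q) * real (card (verts G)) ^ m"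
        using containers_capture_few_lists[OF V(1) _ \<eta>1 ub(1), of "members_in P G" f C] f C fC e
        by (simp add: Pi_iff image_iff)
      also have "\<dots> \<le> 1/3 * real n ^ m" unfolding n_def by (intro mult_right_mono ub(2)) auto
      finally show ?thesis using n0 by (simp add: divide_le_eq)
    qed
  qed
  then show ?thesis
    unfolding m_def[symmetric] reject_prob_sampling_tester[OF G] n_def by linarith
qed

text \<open>Both summands of the sample size have the form bounded here, with \<open>x\<^sup>2\<close> one of the two summands of
  \<open>X\<close>. As \<open>x \<ge> 1\<close>, rounding up and the constant \<open>c\<close> are absorbed by the logarithm, so squaring the
  sample size gives \<open>X\<close> times a squared logarithm.\<close>

lemma sqrt_log_bound:
  fixes x X c d :: real
  assumes x: "1 \<le> x" "x\<^sup>2 \<le> X" and c: "0 \<le> c" "0 \<le> d"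
  shows "real (nat \<lceil>x * (c + d * ln x)\<rceil>) \<le> (c + d + 1) * (sqrt X * log 2 (2 + X))"
proof -
  have X: "1 \<le> X" using x by (smt (verit) one_le_power)
  have sq: "x \<le> sqrt X" using x by (simp add: real_le_rsqrt)
  have "log 2 2 \<le> log 2 (2 + X)" using X by (subst log_le_cancel_iff) auto
  then have L1: "1 \<le> log 2 (2 + X)" by simp
  have "x \<le> X" using x X by (smt (verit) power2_eq_square mult_le_cancel_left1)
  have "ln x \<le> ln (2 + X)" using x \<open>x \<le> X\<close> by (subst ln_le_cancel_iff) auto
  also have "\<dots> \<le> log 2 (2 + X)"
  proof -
    have "ln (2::real) \<le> 2 - 1" by (intro ln_le_minus_one) auto
    then show ?thesis using X by (simp add: log_def field_simps mult_le_cancel_left1)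
  qed
  finally have L2: "ln x \<le> log 2 (2 + X)" .
  have "real (nat \<lceil>x * (c + d * ln x)\<rceil>) \<le> x * (c + d * ln x) + 1"
  proof -
    have "0 \<le> x * (c + d * ln x)" using x c by simp
    then have "real (nat \<lceil>x * (c + d * ln x)\<rceil>) = of_int \<lceil>x * (c + d * ln x)\<rceil>" by simp
    then show ?thesis by linarith
  qed
  also have "\<dots> \<le> x * (c * log 2 (2 + X) + d * log 2 (2 + X)) + x * log 2 (2 + X)"
  proof (intro add_mono mult_left_mono)
    show "c \<le> c * log 2 (2 + X)" using c L1 by (simp add: mult_le_cancel_left1)
    show "1 \<le> x * log 2 (2 + X)" using mult_mono[OF x(1) L1] x by simp
  qed (use x c L2 in auto)
  also have "\<dots> = x * ((c + d + 1) * log 2 (2 + X))" by (simp add: algebra_simps)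
  also have "\<dots> \<le> sqrt X * ((c + d + 1) * log 2 (2 + X))"
    using sq c L1 by (intro mult_right_mono) auto
  finally show ?thesis by (simp add: algebra_simps)
qed

lemma container_sample_size_bound:
  assumes \<eta>: "0 < \<eta>"
  shows "real (container_sample_size N \<eta> q) ^ 2 \<le> soft_bound 169 2 (container_query_bound N \<eta> q)"
proof -
  define X where "X = container_query_bound N \<eta> q"
  define B where "B = sqrt X * log 2 (2 + X)"
  have X: "0 \<le> X" "(real N)\<^sup>2 \<le> X" "((real q + 1) / \<eta>)\<^sup>2 \<le> X"
    by (auto simp: X_def container_query_bound_def power_divide)
  have B0: "0 \<le> B" using X(1) by (simp add: B_def)
  have "real (if N = 0 then 0 else nat \<lceil>real N * (ln (real N) + 2)\<rceil>) \<le> 4 * B"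
    using sqrt_log_bound[OF _ X(2), of 2 1] B0 by (simp add: B_def add.commute)
  moreover have "real (if 1 < \<eta> then 0
      else nat \<lceil>(real q + 1) / \<eta> * (6 + 2 * ln ((real q + 1) / \<eta>))\<rceil>) \<le> 9 * B"
  proof (cases "1 < \<eta>")
    case False
    then have "1 \<le> (real q + 1) / \<eta>" using \<eta> by (simp add: field_simps)
    from sqrt_log_bound[OF this X(3), of 6 2] show ?thesis using False by (simp add: B_def)
  qed (use B0 in simp)
  ultimately have "real (container_sample_size N \<eta> q) \<le> 13 * B"
    unfolding container_sample_size_def of_nat_add by linarith
  then have "real (container_sample_size N \<eta> q) ^ 2 \<le> (13 * B) ^ 2" by (intro power_mono) auto
  also have "\<dots> = soft_bound 169 2 X"
    using X(1) by (simp add: soft_bound_def B_def power_mult_distrib)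
  finally show ?thesis by (simp add: X_def)
qed

lemma query_complexity_le_mono:
  "query_complexity_le A B \<Longrightarrow> B \<le> B' \<Longrightarrow> query_complexity_le A B'"
  unfolding query_complexity_le_def by (blast intro: order_trans)

lemma container_imp_tester:
  assumes P: "hereditary_property P"
    and cont: "\<And>\<epsilon>. 0 < \<epsilon> \<Longrightarrow> ordered_container_lemma P \<epsilon> (\<eta> \<epsilon>) (N \<epsilon>) (q \<epsilon>)"
  shows "admits_one_sided_tester P {0<..}
    (\<lambda>\<epsilon>. soft_bound 169 2 (container_query_bound (N \<epsilon>) (\<eta> \<epsilon>) (q \<epsilon>)))"
proof -
  define T where "T = (\<lambda>\<epsilon>. sampling_tester P (container_sample_size (N \<epsilon>) (\<eta> \<epsilon>) (q \<epsilon>)))"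
  have cost: "query_complexity_le (sampling_tester P m) (real (m * m))"
    "sample_complexity_le (sampling_tester P m) (real m)" for m
    unfolding query_complexity_le_def sample_complexity_le_def
    by (auto simp: input_graph_def run_sampling_tester)
  have "query_complexity_le (T \<epsilon>) (soft_bound 169 2 (container_query_bound (N \<epsilon>) (\<eta> \<epsilon>) (q \<epsilon>)))"
    if "0 < \<epsilon>" for \<epsilon>
  proof -
    have "0 < \<eta> \<epsilon>" using cont[OF that] by (simp add: ordered_container_lemma_def)
    from container_sample_size_bound[OF this] show ?thesis
      unfolding T_def by (intro query_complexity_le_mono[OF cost(1)]) (simp add: power2_eq_square)
  qed
  moreover have "one_sided_tester P T"
    unfolding one_sided_tester_def size_oblivious_tester_def T_def
  proof (intro conjI allI impI)
    fix \<epsilon> :: real assume e: "0 < \<epsilon>"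
    let ?S = "sampling_tester P (container_sample_size (N \<epsilon>) (\<eta> \<epsilon>) (q \<epsilon>))"
    show "queries_sampled {} ?S" by (rule queries_sampled_sampling_tester)
    show "\<exists>B. query_complexity_le ?S B" by (rule exI) (rule cost(1))
    show "\<exists>B. sample_complexity_le ?S B" by (rule exI) (rule cost(2))
    fix G
    {
      assume "input_graph G \<and> G \<in> P"
      then show "accept_prob G ?S = 1" using accept_prob_sampling_tester P by blast
      then show "2/3 \<le> accept_prob G ?S" by simp
    }
    assume "input_graph G \<and> far \<epsilon> G P"
    then show "2/3 \<le> reject_prob G ?S"
      using sampling_tester_rejects_far[OF P cont[OF e]] by blast
  qed
  ultimately show ?thesis
    unfolding admits_one_sided_tester_def by (intro exI[of _ T]) simp
qed

section \<open>The equivalence\<close>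

theorem theorem1p4:
  "(\<forall>c\<^sub>0 K\<^sub>0 :: real. 0 < c\<^sub>0 \<and> 0 < K\<^sub>0 \<longrightarrow>
     (\<exists>c K :: real. 0 < c \<and> c < 1 \<and> 0 < K \<and>
       (\<forall>(P :: graph set) (Q :: real \<Rightarrow> nat).
          hereditary_property P \<and> canonicalization_convention c\<^sub>0 K\<^sub>0 P Q
          \<and> admits_one_sided_tester P {0<..<1} (\<lambda>\<epsilon>. real (Q \<epsilon>)) \<longrightarrow>
          (\<exists>(\<eta> :: real \<Rightarrow> real) (N :: real \<Rightarrow> nat) (q :: real \<Rightarrow> nat). \<forall>\<epsilon>>0.
             ordered_container_lemma P \<epsilon> (\<eta> \<epsilon>) (N \<epsilon>) (q \<epsilon>)
             \<and> (c * \<epsilon> < 1 \<longrightarrow>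
                  real (q \<epsilon>) \<le> K * real (Q (c * \<epsilon>))
                  \<and> \<eta> \<epsilon> \<ge> inverse (real (Q (c * \<epsilon>))) / K
                  \<and> real (N \<epsilon>) \<le> K * real (Q (c * \<epsilon>)))))))
   \<and>
   (\<exists>(K :: real) (k :: nat). 0 < K \<and>
     (\<forall>(P :: graph set) (\<eta> :: real \<Rightarrow> real) (N :: real \<Rightarrow> nat) (q :: real \<Rightarrow> nat).
        hereditary_property P
        \<and> (\<forall>\<epsilon>>0. ordered_container_lemma P \<epsilon> (\<eta> \<epsilon>) (N \<epsilon>) (q \<epsilon>)) \<longrightarrow>
        admits_one_sided_tester P {0<..}
          (\<lambda>\<epsilon>. soft_bound K k (container_query_bound (N \<epsilon>) (\<eta> \<epsilon>) (q \<epsilon>)))))"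
proof (intro conjI allI impI)
  fix c\<^sub>0 K\<^sub>0 :: real
  assume "0 < c\<^sub>0 \<and> 0 < K\<^sub>0"
  then show "\<exists>c K :: real. 0 < c \<and> c < 1 \<and> 0 < K \<and>
       (\<forall>(P :: graph set) (Q :: real \<Rightarrow> nat).
          hereditary_property P \<and> canonicalization_convention c\<^sub>0 K\<^sub>0 P Q
          \<and> admits_one_sided_tester P {0<..<1} (\<lambda>\<epsilon>. real (Q \<epsilon>)) \<longrightarrow>
          (\<exists>(\<eta> :: real \<Rightarrow> real) (N :: real \<Rightarrow> nat) (q :: real \<Rightarrow> nat). \<forall>\<epsilon>>0.
             ordered_container_lemma P \<epsilon> (\<eta> \<epsilon>) (N \<epsilon>) (q \<epsilon>)
             \<and> (c * \<epsilon> < 1 \<longrightarrow>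
                  real (q \<epsilon>) \<le> K * real (Q (c * \<epsilon>))
                  \<and> \<eta> \<epsilon> \<ge> inverse (real (Q (c * \<epsilon>))) / K
                  \<and> real (N \<epsilon>) \<le> K * real (Q (c * \<epsilon>)))))"
    by (elim conjE) (rule tester_imp_container)
next
  show "\<exists>(K :: real) (k :: nat). 0 < K \<and>
     (\<forall>(P :: graph set) (\<eta> :: real \<Rightarrow> real) (N :: real \<Rightarrow> nat) (q :: real \<Rightarrow> nat).
        hereditary_property P
        \<and> (\<forall>\<epsilon>>0. ordered_container_lemma P \<epsilon> (\<eta> \<epsilon>) (N \<epsilon>) (q \<epsilon>)) \<longrightarrow>
        admits_one_sided_tester P {0<..}
          (\<lambda>\<epsilon>. soft_bound K k (container_query_bound (N \<epsilon>) (\<eta> \<epsilon>) (q \<epsilon>))))"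
  proof (rule exI[of _ 169], rule exI[of _ 2], intro conjI allI impI)
    fix P :: "graph set" and \<eta> :: "real \<Rightarrow> real" and N q :: "real \<Rightarrow> nat"
    assume "hereditary_property P
      \<and> (\<forall>\<epsilon>>0. ordered_container_lemma P \<epsilon> (\<eta> \<epsilon>) (N \<epsilon>) (q \<epsilon>))"
    then show "admits_one_sided_tester P {0<..}
      (\<lambda>\<epsilon>. soft_bound 169 2 (container_query_bound (N \<epsilon>) (\<eta> \<epsilon>) (q \<epsilon>)))"
      by (intro container_imp_tester) auto
  qed simp
qed

end
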